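(* Let $P$ be a nonempty convex open subset of $\mathbb{R}^2_{\geq 0}$ whose closure $\overline{P}$ is compact. Let $p_x : \mathbb{R}^2_{\geq 0} \to \mathbb{R}_{\geq 0}$ be the projection onto the positive $x$-axis and set $[a,b] := p_x(\overline{P})$. Define \[ f : [a,b] \to \mathbb{R}_{\geq 0}, \qquad t \mapsto f(t) := \text{length of } p_x^{-1}(t) \cap \overline{P}, \] and let $f^\# : (0, b-a] \to \mathbb{R}_{\geq 0}$ be the monotone reordering of $f$. Let $m \in \mathbb{R}_{>0}$. If $m < b-a$ and $f^\#(t) \geq t$ for all $t \in (0,m]$, then $P$ contains asymptotically $(m)$-non-special systems of dimension $-1$.
   Context: Here $\mathbb{N}$ includes $0$. Monotone reordering: for a measurable function $f : [a,b] \to \mathbb{R}$, its monotone reordering $f^\#$ on $(0, b-a]$ is defined by $f^\#(t) := \inf \{ s \in \mathbb{R} : t \leq \text{length of } \{ t' \in [a,b] : f(t') \leq s \} \}$, where length means Lebesgue measure. Linear systems: for a finite set $D \subset \mathbb{N}^2$ and $m \in \mathbb{N}$, $\mathcal{L}_D(m)$ denotes the projective space of (curve equations given by) nonzero polynomials $\sum_{(\alpha,\beta) \in D} c_{\alpha,\beta} x^\alpha y^\beta$, $c_{\alpha,\beta} \in \mathbb{C}$, up to scalars, which vanish with multiplicity at least $m$ at a general point of the plane. Dimension means projective dimension, and the empty system has dimension $-1$. The expected dimension is $\max\left(-1,\ \#D - 1 - \frac{m(m+1)}{2}\right)$. The system is non-special if its dimension equals its expected dimension. "Non-special of dimension $-1$"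 means that the system is empty and $\#D = \frac{m(m+1)}{2}$ (so that $\#D - 1 - \frac{m(m+1)}{2} = -1$ exactly). Asymptotic systems: let $m \in \mathbb{R}_{>0}$. A subset $P \subset \mathbb{R}^2_{\geq 0}$ contains asymptotically $(m)$-non-special systems of dimension $-1$ iff for all $\delta > 0$ and all sufficiently large integers $k$ there exist $m^{(k)} \in \mathbb{N}$ and a finite set $D_k \subset (k \cdot P) \cap \mathbb{N}^2$ such that (i) $\mathcal{L}_{D_k}(m^{(k)})$ is non-special of dimension $-1$, and (ii) $\left| \frac{m^{(k)} - k m}{k m} \right| < \delta$. *)

theory Defs
  imports "HOL-Analysis.Analysis" "HOL-Computational_Algebra.Polynomial"
begin

section \<open>Plane curves of prescribed support and multiplicity\<close>

text \<open>
  A polynomial in \<open>x\<close>, \<open>y\<close> over the complex numbers is an element of \<open>complex poly poly\<close>: the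
  outer variable is \<open>y\<close>, the inner one is \<open>x\<close>, so that the coefficient of \<open>x\<^sup>\<alpha> y\<^sup>\<beta>\<close> in \<open>p\<close> is
  \<open>coeff (coeff p \<beta>) \<alpha>\<close>.
\<close>

definition poly2 :: "complex poly poly \<Rightarrow> complex \<Rightarrow> complex \<Rightarrow> complex" where
  "poly2 p x y = poly (poly p [:y:]) x"

definition support2 :: "complex poly poly \<Rightarrow> (nat \<times> nat) set" where
  "support2 p = {(\<alpha>, \<beta>). coeff (coeff p \<beta>) \<alpha> \<noteq> 0}"

definition pderiv_x :: "complex poly poly \<Rightarrow> complex poly poly" where
  "pderiv_x p = map_poly pderiv p"

abbreviation pderiv_y :: "complex poly poly \<Rightarrow> complex poly poly" where
  "pderiv_y \<equiv> pderiv"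

definition vanishes_to_order :: "complex poly poly \<Rightarrow> nat \<Rightarrow> complex \<Rightarrow> complex \<Rightarrow> bool" where
  "vanishes_to_order p m x y \<longleftrightarrow>
     (\<forall>i j. i + j < m \<longrightarrow> poly2 ((pderiv_x ^^ i) ((pderiv_y ^^ j) p)) x y = 0)"

text \<open>A property holds at a general point if it holds off some algebraic curve \<open>g = 0\<close>.\<close>

definition at_general_point :: "(complex \<Rightarrow> complex \<Rightarrow> bool) \<Rightarrow> bool" where
  "at_general_point Q \<longleftrightarrow> (\<exists>g. g \<noteq> 0 \<and> (\<forall>x y. poly2 g x y \<noteq> 0 \<longrightarrow> Q x y))"

text \<open>
  The system with multiplicity imposed at the point \<open>(x, y)\<close>, given by its set of (nonzero)
  equations; the projective space is the quotient of this set by nonzero scalars.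
\<close>

definition linear_system ::
    "(nat \<times> nat) set \<Rightarrow> nat \<Rightarrow> complex \<Rightarrow> complex \<Rightarrow> complex poly poly set" where
  "linear_system D m x y = {p. p \<noteq> 0 \<and> support2 p \<subseteq> D \<and> vanishes_to_order p m x y}"

global_interpretation poly2: vector_space "\<lambda>(c::complex) (p::complex poly poly). smult [:c:] p"
  by unfold_locales (simp_all add: smult_add_right smult_add_left [symmetric] mult.commute
      one_pCons [symmetric])

text \<open>
  \<open>poly2.dim\<close> of a set is the vector space dimension of its linear span, so projective
  dimension is one less; the empty set has \<open>poly2.dim = 0\<close>, hence projective dimension \<open>-1\<close>.
\<close>

definition has_system_dim :: "(nat \<times> nat) set \<Rightarrow> nat \<Rightarrow> int \<Rightarrow> bool" where
  "has_system_dim D m d \<longleftrightarrow>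
     at_general_point (\<lambda>x y. int (poly2.dim (linear_system D m x y)) - 1 = d)"

definition expected_dim :: "(nat \<times> nat) set \<Rightarrow> nat \<Rightarrow> int" where
  "expected_dim D m = max (-1) (int (card D) - 1 - int (m * (m + 1) div 2))"

definition non_special :: "(nat \<times> nat) set \<Rightarrow> nat \<Rightarrow> bool" where
  "non_special D m \<longleftrightarrow> has_system_dim D m (expected_dim D m)"

text \<open>
  Non-special of dimension \<open>-1\<close>: empty, with the maximum in \<open>expected_dim\<close> attained by both of
  its arguments.
\<close>

definition non_special_of_dim_minus_one :: "(nat \<times> nat) set \<Rightarrow> nat \<Rightarrow> bool" where
  "non_special_of_dim_minus_one D m \<longleftrightarrow>
     at_general_point (\<lambda>x y. linear_system D m x y = {}) \<and> card D = m * (m + 1) div 2"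

lemma poly2_nonzero_exists:
  assumes "g \<noteq> 0"
  shows "\<exists>x y. poly2 g x y \<noteq> 0"
proof -
  obtain y where y: "poly g [:y:] \<noteq> 0"
  proof (rule ccontr)
    assume "\<not> thesis"
    then have "range (\<lambda>y. [:y:]) \<subseteq> {q. poly g q = 0}"
      using that by auto
    moreover have "infinite (range (\<lambda>y::complex. [:y:]))"
      using finite_imageD [of "\<lambda>y::complex. [:y:]" UNIV] infinite_UNIV_char_0
      by (auto simp: inj_on_def)
    ultimately show False
      using poly_roots_finite [OF assms] finite_subset by blast
  qed
  have "\<exists>x. poly (poly g [:y:]) x \<noteq> 0"
    using y poly_all_0_iff_0 by blast
  then show ?thesis
    by (auto simp: poly2_def)
qed

lemma has_system_dim_unique:
  assumes "has_system_dim D m d" "has_system_dim D m e"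
  shows "d = e"
proof -
  obtain g h where g: "g \<noteq> 0"
      "\<And>x y. poly2 g x y \<noteq> 0 \<Longrightarrow> int (poly2.dim (linear_system D m x y)) - 1 = d"
    and h: "h \<noteq> 0"
      "\<And>x y. poly2 h x y \<noteq> 0 \<Longrightarrow> int (poly2.dim (linear_system D m x y)) - 1 = e"
    using assms unfolding has_system_dim_def at_general_point_def by blast
  obtain x y where "poly2 (g * h) x y \<noteq> 0"
    using poly2_nonzero_exists [of "g * h"] g(1) h(1) by auto
  then have "poly2 g x y \<noteq> 0" "poly2 h x y \<noteq> 0"
    by (auto simp: poly2_def)
  then show ?thesis
    using g(2) h(2) by metis
qed

lemma span_monomials:
  assumes "finite D" "support2 p \<subseteq> D"
  shows "p \<in> poly2.span ((\<lambda>(\<alpha>, \<beta>). monom (monom 1 \<alpha>) \<beta>) ` D)"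
proof -
  have "p = (\<Sum>(\<alpha>, \<beta>)\<in>D. smult [:coeff (coeff p \<beta>) \<alpha>:] (monom (monom 1 \<alpha>) \<beta>))" (is "_ = ?q")
  proof (intro poly_eqI)
    fix j i
    have "coeff (coeff ?q j) i =
        (\<Sum>v\<in>D. if v = (i, j) then coeff (coeff p (snd v)) (fst v) else 0)"
      unfolding coeff_sum by (intro sum.cong) (auto split: if_splits simp: monom_eq_iff)
    also have "\<dots> = coeff (coeff p j) i"
      using assms by (auto simp: support2_def)
    finally show "coeff (coeff p j) i = coeff (coeff ?q j) i" ..
  qed
  moreover have "?q \<in> poly2.span ((\<lambda>(\<alpha>, \<beta>). monom (monom 1 \<alpha>) \<beta>) ` D)"
    by (rule poly2.span_sum, clarify, rule poly2.span_scale, rule poly2.span_base) force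
  ultimately show ?thesis
    by metis
qed

lemma dim_linear_system_eq_0_iff:
  assumes "finite D"
  shows "poly2.dim (linear_system D m x y) = 0 \<longleftrightarrow> linear_system D m x y = {}"
proof
  assume dim: "poly2.dim (linear_system D m x y) = 0"
  obtain B where B: "B \<subseteq> linear_system D m x y" "poly2.independent B"
      "linear_system D m x y \<subseteq> poly2.span B" "card B = poly2.dim (linear_system D m x y)"
    using poly2.basis_exists by blast
  have "B \<subseteq> poly2.span ((\<lambda>(\<alpha>, \<beta>). monom (monom 1 \<alpha>) \<beta>) ` D)"
    using B(1) span_monomials [OF assms] by (auto simp: linear_system_def)
  then have "finite B"
    using poly2.independent_span_bound [OF _ B(2)] assms by blast
  then have "B = {}"
    using B(4) dim by simp
  then show "linear_system D m x y = {}"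
    using B(3) by (auto simp: linear_system_def)
next
  assume "linear_system D m x y = {}"
  then show "poly2.dim (linear_system D m x y) = 0"
    using poly2.dim_le_card [of "{}" "{}"] by simp
qed

lemma non_special_of_dim_minus_one_iff:
  assumes "finite D"
  shows "non_special_of_dim_minus_one D m \<longleftrightarrow>
    non_special D m \<and> has_system_dim D m (-1) \<and> int (card D) - 1 - int (m * (m + 1) div 2) = -1"
  using dim_linear_system_eq_0_iff [OF assms, of m]
  by (auto simp: non_special_of_dim_minus_one_def non_special_def has_system_dim_def
      expected_dim_def)


section \<open>Asymptotic systems and monotone reordering\<close>

definition contains_asymptotically_non_special :: "(real \<times> real) set \<Rightarrow> real \<Rightarrow> bool" where
  "contains_asymptotically_non_special P m \<longleftrightarrow>
     (\<forall>\<delta>>0. \<forall>\<^sub>F k::nat in sequentially. \<exists>(m\<^sub>k::nat) D\<^sub>k.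
        finite D\<^sub>k \<and>
        (\<forall>(\<alpha>, \<beta>)\<in>D\<^sub>k. (real \<alpha>, real \<beta>) \<in> (\<lambda>v. real k *\<^sub>R v) ` P) \<and>
        non_special_of_dim_minus_one D\<^sub>k m\<^sub>k \<and>
        \<bar>(real m\<^sub>k - real k * m) / (real k * m)\<bar> < \<delta>)"

definition quadrant :: "(real \<times> real) set" where
  "quadrant = {(x, y). 0 \<le> x \<and> 0 \<le> y}"

definition fibre_length :: "(real \<times> real) set \<Rightarrow> real \<Rightarrow> real" where
  "fibre_length K t = measure lebesgue {y. (t, y) \<in> K}"

definition monotone_reordering :: "real \<Rightarrow> real \<Rightarrow> (real \<Rightarrow> real) \<Rightarrow> real \<Rightarrow> real" where
  "monotone_reordering a b f t = Inf {s. t \<le> measure lebesgue {t' \<in> {a..b}. f t' \<le> s}}"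

end

theory Submission
  imports Defs
begin

text \<open>
  On the torus, vanishing to order \<open>M\<close> at \<open>(x, y)\<close> says that the vector of the terms
  \<open>c\<^sub>\<alpha>\<^sub>\<beta> x\<^sup>\<alpha> y\<^sup>\<beta>\<close> is orthogonal to all polynomials in \<open>(\<alpha>, \<beta>)\<close> of degree less than \<open>M\<close>. If the
  support consists of \<open>M\<close> columns with \<open>1, 2, \<dots>, M\<close> points, this forces the vector to
  vanish: multiplying by \<open>\<alpha> - \<alpha>\<^sub>0\<close>, with \<open>\<alpha>\<^sub>0\<close> the longest column, reduces to \<open>M - 1\<close> columns,
  and the longest column is then a Vandermonde problem. It remains to find such columns in
  \<open>k P\<close>. The hypothesis on the monotone reordering says that the abscissae with fibre longer
  than \<open>j / k\<close> fill an interval of length at least \<open>b - a - j / k\<close>. Hence at least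
  \<open>k (b - a) - j - 1\<close> columns of \<open>k P\<close> contain \<open>j\<close> lattice points, and since \<open>m < b - a\<close> the
  columns can be chosen greedily, starting from the longest one.
\<close>

section \<open>Interpolation on columns of increasing length\<close>

text \<open>The falling factorial n(n-1)...(n-i+1), the scalar that arises on differentiating z^n i
  times. As a polynomial in n it has degree i, so these serve as the Newton basis in place of
  powers.\<close>

definition falling :: "nat \<Rightarrow> nat \<Rightarrow> 'a::comm_ring_1" where
  "falling i n = (\<Prod>l<i. of_nat n - of_nat l)"

lemma falling_0 [simp]: "falling 0 n = 1"
  by (simp add: falling_def)

lemma falling_Suc: "falling (Suc i) n = (of_nat n - of_nat i) * falling i n"
  by (simp add: falling_def mult.commute)

lemma falling_eq_0: "n < i \<Longrightarrow> falling i n = 0"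
  unfolding falling_def by (rule prod_zero) auto

text \<open>A linear factor raises the falling degree by at most one, so a moment against
  \<open>of_nat n - of_nat b\<close> times a falling factorial is a combination of two consecutive
  moments.\<close>

lemma diff_times_falling:
  "(of_nat n - of_nat b) * falling i n = falling (Suc i) n + (of_nat i - of_nat b) * falling i n"
  by (simp add: falling_Suc algebra_simps)

text \<open>Vandermonde in the Newton basis, by induction on \<open>B\<close>. The weights
  \<open>c \<beta> * (of_nat \<beta> - of_nat b)\<close> lose the point \<open>b\<close> at the
  price of one moment, so the induction hypothesis kills them; moment 0 then isolates
  \<open>c b\<close>.\<close>

lemma falling_moments_zero:
  fixes c :: "nat \<Rightarrow> 'a::field_char_0"
  assumes "finite B" "\<And>j. j < card B \<Longrightarrow> (\<Sum>\<beta>\<in>B. c \<beta> * falling j \<beta>) = 0" "\<beta> \<in> B"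
  shows "c \<beta> = 0"
  using assms
proof (induction B arbitrary: c \<beta> rule: finite_induct)
  case empty
  then show ?case by simp
next
  case (insert b B)
  have off: "c \<gamma> = 0" if "\<gamma> \<in> B" for \<gamma>
  proof -
    have "(\<Sum>\<beta>\<in>B. c \<beta> * (of_nat \<beta> - of_nat b) * falling j \<beta>) = 0" if "j < card B" for j
    proof -
      have "(\<Sum>\<beta>\<in>B. c \<beta> * (of_nat \<beta> - of_nat b) * falling j \<beta>) =
          (\<Sum>\<beta>\<in>insert b B. c \<beta> * (of_nat \<beta> - of_nat b) * falling j \<beta>)"
        using insert.hyps by simp
      also have "\<dots> = (\<Sum>\<beta>\<in>insert b B. c \<beta> * falling (Suc j) \<beta>) +
          (of_nat j - of_nat b) * (\<Sum>\<beta>\<in>insert b B. c \<beta> * falling j \<beta>)"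
        unfolding sum_distrib_left sum.distrib [symmetric] mult.assoc diff_times_falling
        by (intro sum.cong) (auto simp: algebra_simps)
      also have "\<dots> = 0"
        using insert.prems(1) [of j] insert.prems(1) [of "Suc j"] insert.hyps that by simp
      finally show ?thesis .
    qed
    then have "c \<gamma> * (of_nat \<gamma> - of_nat b) = 0"
      using that insert.IH [of "\<lambda>\<beta>. c \<beta> * (of_nat \<beta> - of_nat b)" \<gamma>] by blast
    then show ?thesis
      using that insert.hyps by auto
  qed
  moreover have "c b = 0"
    using insert.prems(1) [of 0] insert.hyps off by simp
  ultimately show ?case
    using insert.prems by auto
qed

text \<open>The factor \<open>?d l\<close> deletes the longest column and costs one degree. The
  induction hypothesis clears the shorter columns, as \<open>?d l\<close> is nonzero there by
  injectivity of \<open>g\<close>.\<close>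

lemma falling_moments_columns_zero:
  fixes c :: "nat \<Rightarrow> nat \<Rightarrow> 'a::field_char_0"
  assumes "inj_on g {..<M}" "\<And>l. l < M \<Longrightarrow> finite (B l)" "\<And>l. l < M \<Longrightarrow> card (B l) = Suc l"
    and "\<And>i j. i + j < M \<Longrightarrow>
      (\<Sum>l<M. \<Sum>\<beta>\<in>B l. c l \<beta> * (falling i (g l) * falling j \<beta>)) = 0"
    and "l < M" "\<beta> \<in> B l"
  shows "c l \<beta> = 0"
  using assms
proof (induction M arbitrary: c l \<beta>)
  case 0
  then show ?case by simp
next
  case (Suc M)
  let ?d = "\<lambda>l. of_nat (g l) - of_nat (g M) :: 'a"
  have off: "c l' \<beta>' = 0" if "l' < M" "\<beta>' \<in> B l'" for l' \<beta>'
  proof -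
    have "(\<Sum>l<M. \<Sum>\<beta>\<in>B l. c l \<beta> * ?d l * (falling i (g l) * falling j \<beta>)) = 0"
      if "i + j < M" for i j
    proof -
      have "(\<Sum>l<M. \<Sum>\<beta>\<in>B l. c l \<beta> * ?d l * (falling i (g l) * falling j \<beta>)) =
          (\<Sum>l<Suc M. \<Sum>\<beta>\<in>B l. c l \<beta> * falling j \<beta> * (?d l * falling i (g l)))"
        by (simp add: mult_ac)
      also have "\<dots> = (\<Sum>l<Suc M. \<Sum>\<beta>\<in>B l. c l \<beta> * (falling (Suc i) (g l) * falling j \<beta>)) +
          (of_nat i - of_nat (g M)) *
          (\<Sum>l<Suc M. \<Sum>\<beta>\<in>B l. c l \<beta> * (falling i (g l) * falling j \<beta>))"
        unfolding sum_distrib_left sum.distrib [symmetric] diff_times_falling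
        by (intro sum.cong) (auto simp: algebra_simps)
      also have "\<dots> = 0"
        using Suc.prems(4) [of i j] Suc.prems(4) [of "Suc i" j] that
        by (simp del: sum.lessThan_Suc)
      finally show ?thesis .
    qed
    then have "c l' \<beta>' * ?d l' = 0"
      using that Suc.IH [of "\<lambda>l \<beta>. c l \<beta> * ?d l" l' \<beta>'] Suc.prems(1-3)
      by (auto simp: lessThan_Suc inj_on_insert)
    moreover have "g l' \<noteq> g M"
      using Suc.prems(1) that(1) by (auto simp: inj_on_def)
    ultimately show ?thesis
      by simp
  qed
  \<comment> \<open>The moments with i = 0 now involve the last column only, and there are as many
    of them as it has points, namely M + 1.\<close>
  have "c M \<gamma> = 0" if "\<gamma> \<in> B M" for \<gamma>
  proof (rule falling_moments_zero [of "B M" "c M"])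
    show "(\<Sum>\<beta>\<in>B M. c M \<beta> * falling j \<beta>) = 0" if "j < card (B M)" for j
      using Suc.prems(4) [of 0 j] Suc.prems(3) [of M] that off by simp
  qed (use Suc.prems(2) that in auto)
  then show ?case
    using Suc.prems(5,6) off less_Suc_eq by blast
qed


section \<open>Derivatives of monomials\<close>

lemma higher_pderiv_monom:
  fixes c :: "'a::idom"
  shows "(pderiv ^^ i) (monom c n) = monom (falling i n * c) (n - i)"
proof (induction i)
  case (Suc i)
  \<comment> \<open>For i > n the subtraction truncates to 0, and the right side vanishes as
    well.\<close>
  have "of_nat (n - i) * falling i n = (falling (Suc i) n :: 'a)"
    by (cases "i \<le> n") (auto simp: falling_Suc of_nat_diff falling_eq_0)
  then show ?case
    by (simp add: Suc.IH pderiv_monom mult.assoc [symmetric])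
qed simp

text \<open>Differentiation in y yields scalars in the ring of polynomials in x; this turns them
  back into constants.\<close>

lemma falling_pCons: "falling j n = [:falling j n :: 'a::idom:]"
  by (induction j) (simp_all add: falling_Suc of_nat_poly one_pCons)

lemma higher_pderiv_x_monom: "(pderiv_x ^^ i) (monom q n) = monom ((pderiv ^^ i) q) n"
  by (induction i) (simp_all add: pderiv_x_def map_poly_monom)

lemma pderiv_x_sum: "pderiv_x (sum f A) = (\<Sum>v\<in>A. pderiv_x (f v))"
  by (intro poly_eqI) (simp add: pderiv_x_def coeff_map_poly coeff_sum higher_pderiv_sum [of 1, simplified])

lemma higher_pderiv_x_sum: "(pderiv_x ^^ i) (sum f A) = (\<Sum>v\<in>A. (pderiv_x ^^ i) (f v))"
  by (induction i) (simp_all add: pderiv_x_sum)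

lemma poly2_sum: "poly2 (sum f A) x y = (\<Sum>v\<in>A. poly2 (f v) x y)"
  by (simp add: poly2_def poly_sum)

lemma poly2_monom: "poly2 (monom (monom c \<alpha>) \<beta>) x y = c * x ^ \<alpha> * y ^ \<beta>"
  by (simp add: poly2_def poly_monom poly_power)

text \<open>The factor x^i y^j restores the exponents lowered by differentiation. Where an exponent
  is truncated, the falling factorial is zero.\<close>

lemma poly2_derivative_monom:
  "poly2 ((pderiv_x ^^ i) ((pderiv_y ^^ j) (monom (monom c \<alpha>) \<beta>))) x y * (x ^ i * y ^ j) =
    c * x ^ \<alpha> * y ^ \<beta> * (falling i \<alpha> * falling j \<beta>)"
proof -
  have *: "falling i n * z ^ (n - i) * z ^ i = falling i n * z ^ n" for i n and z :: complex
    by (cases "i \<le> n") (simp_all add: mult.assoc power_add [symmetric] falling_eq_0)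
  have "poly2 ((pderiv_x ^^ i) ((pderiv_y ^^ j) (monom (monom c \<alpha>) \<beta>))) x y * (x ^ i * y ^ j) =
      c * (falling i \<alpha> * x ^ (\<alpha> - i) * x ^ i) * (falling j \<beta> * y ^ (\<beta> - j) * y ^ j)"
    by (simp add: higher_pderiv_monom higher_pderiv_x_monom falling_pCons smult_monom poly2_monom
        mult_ac)
  then show ?thesis
    unfolding * by (simp add: mult_ac)
qed

lemma sum_monomials:
  assumes "finite D" "support2 p \<subseteq> D"
  shows "p = (\<Sum>(\<alpha>, \<beta>)\<in>D. monom (monom (coeff (coeff p \<beta>) \<alpha>) \<alpha>) \<beta>)" (is "_ = ?q")
proof (intro poly_eqI)
  fix j i
  have "coeff (coeff ?q j) i =
      (\<Sum>v\<in>D. if v = (i, j) then coeff (coeff p (snd v)) (fst v) else 0)"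
    unfolding coeff_sum by (intro sum.cong) (auto split: if_splits)
  also have "\<dots> = coeff (coeff p j) i"
    using assms by (auto simp: support2_def)
  finally show "coeff (coeff p j) i = coeff (coeff ?q j) i" ..
qed

lemma vanishing_moments:
  assumes "finite D" "support2 p \<subseteq> D" "vanishes_to_order p M x y" "i + j < M"
  shows "(\<Sum>(\<alpha>, \<beta>)\<in>D. coeff (coeff p \<beta>) \<alpha> * x ^ \<alpha> * y ^ \<beta> * (falling i \<alpha> * falling j \<beta>)) = 0"
proof -
  have "0 = poly2 ((pderiv_x ^^ i) ((pderiv_y ^^ j) p)) x y * (x ^ i * y ^ j)"
    using assms(3,4) by (simp add: vanishes_to_order_def)
  also have "\<dots> = (\<Sum>(\<alpha>, \<beta>)\<in>D. coeff (coeff p \<beta>) \<alpha> * x ^ \<alpha> * y ^ \<beta> * (falling i \<alpha> * falling j \<beta>))"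
    by (subst sum_monomials [OF assms(1,2)])
      (simp add: higher_pderiv_sum higher_pderiv_x_sum poly2_sum sum_distrib_right
        poly2_derivative_monom case_prod_unfold)
  finally show ?thesis ..
qed

text \<open>The 1 + ... + M points match the number of conditions. Off the axes the values of the
  monomials are nonzero, so the vanishing of all terms of p forces p = 0.\<close>

lemma non_special_columns:
  assumes g: "inj_on g {..<M}"
    and fin: "\<And>l. l < M \<Longrightarrow> finite (B l)" and card: "\<And>l. l < M \<Longrightarrow> card (B l) = Suc l"
  shows "non_special_of_dim_minus_one ((\<lambda>(l, \<beta>). (g l, \<beta>)) ` Sigma {..<M} B) M"
    (is "non_special_of_dim_minus_one ?D M")
proof -
  have inj: "inj_on (\<lambda>(l, \<beta>). (g l, \<beta>)) (Sigma {..<M} B)"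
    using g by (auto simp: inj_on_def)
  have finD: "finite ?D"
    using fin by auto
  have "card ?D = (\<Sum>l<M. Suc l)"
    using inj fin card by (simp add: card_image)
  also have "\<dots> = M * (M + 1) div 2"
    by (induction M) auto
  finally have "card ?D = M * (M + 1) div 2" .
  moreover have "linear_system ?D M x y = {}" if "x \<noteq> 0" "y \<noteq> 0" for x y
  proof (rule ccontr)
    assume "linear_system ?D M x y \<noteq> {}"
    then obtain p where p: "p \<noteq> 0" "support2 p \<subseteq> ?D" "vanishes_to_order p M x y"
      by (auto simp: linear_system_def)
    define c where "c l \<beta> = coeff (coeff p \<beta>) (g l) * x ^ g l * y ^ \<beta>" for l \<beta>
    have "(\<Sum>l<M. \<Sum>\<beta>\<in>B l. c l \<beta> * (falling i (g l) * falling j \<beta>)) = 0" if "i + j < M" for i j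
      using vanishing_moments [OF finD p(2,3) that] fin
      by (simp add: sum.reindex [OF inj, unfolded case_prod_unfold] o_def sum.Sigma c_def
          case_prod_unfold)
    then have "c l \<beta> = 0" if "l < M" "\<beta> \<in> B l" for l \<beta>
      using falling_moments_columns_zero [OF g fin card, of c] that by blast
    then have "support2 p = {}"
      using p(2) that by (fastforce simp: c_def support2_def)
    then have "p = 0"
      using sum_monomials [of "{}" p] by simp
    then show False
      using p(1) by simp
  qed
  then have "at_general_point (\<lambda>x y. linear_system ?D M x y = {})"
    unfolding at_general_point_def
    \<comment> \<open>The excluded curve is xy = 0.\<close>
    by (intro exI [of _ "monom (monom 1 1) 1"]) (auto simp: poly2_monom)
  ultimately show ?thesis
    by (simp add: non_special_of_dim_minus_one_def)
qed


section \<open>Choosing the columns\<close>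

text \<open>At stage n only n elements are taken, and \<open>A n\<close> has more than n.\<close>

lemma distinct_representatives_greedy:
  assumes "\<And>i. i < n \<Longrightarrow> i < card (A i)"
  shows "\<exists>g. inj_on g {..<n} \<and> (\<forall>i<n. g i \<in> A i)"
  using assms
proof (induction n)
  case (Suc n)
  then obtain g where g: "inj_on g {..<n}" "\<forall>i<n. g i \<in> A i"
    by (meson less_Suc_eq)
  have "\<not> A n \<subseteq> g ` {..<n}"
  proof
    assume "A n \<subseteq> g ` {..<n}"
    then have "card (A n) \<le> card {..<n}"
      by (rule surj_card_le [rotated]) simp
    then show False
      using Suc.prems [of n] by simp
  qed
  then obtain x where "x \<in> A n" "x \<notin> g ` {..<n}"
    by blast
  with g show ?case
    by (intro exI [of _ "g(n := x)"]) (auto simp: less_Suc_eq inj_on_def)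
qed simp

section \<open>Lattice points in intervals, and long fibres of convex sets\<close>

lemma open_interval_naturals:
  fixes u v :: real
  assumes "0 \<le> u" "real j < v - u"
  obtains B :: "nat set" where "finite B" "card B = j" "\<And>n. n \<in> B \<Longrightarrow> u < real n \<and> real n < v"
proof
  \<comment> \<open>The j integers after the floor of u: the first exceeds u, the last is at most u
    + j < v.\<close>
  let ?z = "nat \<lfloor>u\<rfloor>"
  show "finite {?z + 1..?z + j}" "card {?z + 1..?z + j} = j"
    by simp_all
  fix n
  assume n: "n \<in> {?z + 1..?z + j}"
  have "real ?z \<le> u" "u < real ?z + 1"
    using assms(1) by (simp_all add: of_nat_nat)
  moreover have "real ?z + 1 \<le> real n" "real n \<le> real ?z + real j"
    using n by (simp_all flip: of_nat_add of_nat_Suc)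
  ultimately show "u < real n \<and> real n < v"
    using assms(2) by linarith
qed

text \<open>Convexity makes the abscissae with fibre longer than s an interval \<open>G\<close>. If
  its complement in [a,b] had measure above s, the reordering at some t in (s, m] would be at most s
  < t, against \<open>re\<close>. The endpoints of \<open>G\<close> serve as p and q.\<close>

lemma long_fibres_interval:
  fixes K :: "(real \<times> real) set"
  assumes K: "convex K" "compact K" "fst ` K = {a..b}" and m: "m < b - a" and s: "0 \<le> s" "s < m"
    and re: "\<forall>t\<in>{0<..m}. t \<le> monotone_reordering a b (fibre_length K) t"
  obtains p q where "a \<le> p" "q \<le> b" "b - a - s \<le> q - p"
    "\<And>t. p < t \<Longrightarrow> t < q \<Longrightarrow> \<exists>y z. (t, y) \<in> K \<and> (t, z) \<in> K \<and> s < z - y"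
proof -
  \<comment> \<open>Membership is expressed by two points of the fibre, so that convexity of
    \<open>G\<close> follows by combining points of \<open>K\<close>.\<close>
  define G where "G = {t. \<exists>y z. (t, y) \<in> K \<and> (t, z) \<in> K \<and> s < z - y}"
  have Gab: "G \<subseteq> {a..b}"
    using K(3) by (force simp: G_def)
  have "convex G"
  proof (rule convexI)
    fix t1 t2 u v :: real
    assume "t1 \<in> G" "t2 \<in> G" and uv: "0 \<le> u" "0 \<le> v" "u + v = 1"
    then obtain y1 z1 y2 z2 where
      1: "(t1, y1) \<in> K" "(t1, z1) \<in> K" "s < z1 - y1" and
      2: "(t2, y2) \<in> K" "(t2, z2) \<in> K" "s < z2 - y2"
      by (auto simp: G_def)
    have "u *\<^sub>R (t1, y1) + v *\<^sub>R (t2, y2) \<in> K" "u *\<^sub>R (t1, z1) + v *\<^sub>R (t2, z2) \<in> K"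
      using convexD [OF K(1)] 1 2 uv by blast+
    moreover have "s < u * (z1 - y1) + v * (z2 - y2)"
      using convex_bound_lt [of "y1 - z1" "- s" "y2 - z2" u v] 1(3) 2(3) uv by (simp add: algebra_simps)
    ultimately show "u *\<^sub>R t1 + v *\<^sub>R t2 \<in> G"
      unfolding G_def mem_Collect_eq
      by (intro exI [of _ "u * y1 + v * y2"] exI [of _ "u * z1 + v * z2"]) (simp add: algebra_simps)
  qed
  then have Gint: "is_interval G"
    by (simp add: is_interval_convex_1)
  \<comment> \<open>Each fibre over [a,b] is a nonempty compact interval, hence its length is the
    largest distance between two of its points.\<close>
  have long_iff: "fibre_length K t \<le> s \<longleftrightarrow> t \<notin> G" if "t \<in> {a..b}" for t
  proof -
    have "compact {y. (t, y) \<in> K}"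
    proof -
      have "{y. (t, y) \<in> K} = snd ` (K \<inter> {t} \<times> UNIV)"
        by force
      then show ?thesis
        using K(2) by (auto intro!: compact_continuous_image continuous_intros compact_Int_closed
            closed_Times)
    qed
    moreover have "convex {y. (t, y) \<in> K}"
    proof (rule convexI)
      fix y z u v :: real
      assume "y \<in> {y. (t, y) \<in> K}" "z \<in> {y. (t, y) \<in> K}" and uv: "0 \<le> u" "0 \<le> v" "u + v = 1"
      then have "u *\<^sub>R (t, y) + v *\<^sub>R (t, z) \<in> K"
        using convexD [OF K(1)] by blast
      moreover have "u * t + v * t = t"
        using uv(3) by (metis distrib_right mult_1)
      ultimately show "u *\<^sub>R y + v *\<^sub>R z \<in> {y. (t, y) \<in> K}"
        by simp
    qed
    ultimately obtain c d where cd: "{y. (t, y) \<in> K} = {c..d}"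
      using connected_compact_interval_1 convex_connected by metis
    moreover have "{y. (t, y) \<in> K} \<noteq> {}"
      using that K(3) by (metis (mono_tags, lifting) empty_Collect_eq imageE prod.collapse)
    ultimately have "c \<le> d"
      by simp
    have mem: "(t, y) \<in> K \<longleftrightarrow> c \<le> y \<and> y \<le> d" for y
      using cd by (metis (mono_tags, lifting) atLeastAtMost_iff mem_Collect_eq)
    have "fibre_length K t = d - c"
      using cd \<open>c \<le> d\<close> by (simp add: fibre_length_def)
    moreover have "t \<in> G \<longleftrightarrow> s < d - c"
      unfolding G_def mem_Collect_eq mem
    proof
      show "\<exists>y z. (c \<le> y \<and> y \<le> d) \<and> (c \<le> z \<and> z \<le> d) \<and> s < z - y \<Longrightarrow> s < d - c"
        by auto
      show "s < d - c \<Longrightarrow> \<exists>y z. (c \<le> y \<and> y \<le> d) \<and> (c \<le> z \<and> z \<le> d) \<and> s < z - y"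
        using \<open>c \<le> d\<close> by auto
    qed
    ultimately show ?thesis
      by auto
  qed
  have short: "measure lebesgue ({a..b} - G) \<le> s"
  proof (rule ccontr)
    assume neg: "\<not> measure lebesgue ({a..b} - G) \<le> s"
    let ?S = "\<lambda>t. {r. t \<le> measure lebesgue {t' \<in> {a..b}. fibre_length K t' \<le> r}}"
    obtain t where t: "s < t" "t \<le> m" "t \<le> measure lebesgue ({a..b} - G)"
      using neg s(2) by (intro that [of "min m (measure lebesgue ({a..b} - G))"]) auto
    have "{t' \<in> {a..b}. fibre_length K t' \<le> s} = {a..b} - G"
      using long_iff by auto
    then have "s \<in> ?S t"
      using t(3) by simp
    \<comment> \<open>\<open>Inf\<close> is a lower bound only for sets bounded below. A negative r
      gives an empty sublevel set, of measure 0 < t.\<close>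
    moreover have "0 \<le> r" if "r \<in> ?S t" for r
    proof (rule ccontr)
      assume "\<not> 0 \<le> r"
      then have "{t' \<in> {a..b}. fibre_length K t' \<le> r} = {}"
        by (auto simp: fibre_length_def dest: order_trans [OF measure_nonneg])
      then show False
        using that t(1) s(1) by (simp only: mem_Collect_eq measure_empty)
    qed
    then have "bdd_below (?S t)"
      by (meson bdd_belowI)
    ultimately have "Inf (?S t) \<le> s"
      by (rule cInf_lower)
    moreover have "t \<le> Inf (?S t)"
      using re t s(1) by (auto simp: monotone_reordering_def)
    ultimately show False
      using t(1) by linarith
  qed
  have Gmeas: "G \<in> lmeasurable"
    using measurable_convex [OF \<open>convex G\<close>] Gab bounded_subset [OF bounded_closed_interval] by blast
  have "measure lebesgue ({a..b} - G) = (b - a) - measure lebesgue G"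
    using measurable_measure_Diff [of "{a..b}" lebesgue G] Gmeas Gab m s by (simp add: fmeasurableD)
  then have G_long: "b - a - s \<le> measure lebesgue G"
    using short by simp
  then have ne: "G \<noteq> {}"
    using m s by auto
  have bdd: "bdd_below G" "bdd_above G"
    using Gab by (meson bdd_below_mono bdd_below_Icc bdd_above_mono bdd_above_Icc)+
  show ?thesis
  proof
    show "a \<le> Inf G" "Sup G \<le> b"
      using Gab ne by (auto intro!: cInf_greatest cSup_least)
    have "G \<subseteq> {Inf G..Sup G}"
      using bdd by (auto intro: cInf_lower cSup_upper)
    then have "measure lebesgue G \<le> measure lebesgue {Inf G..Sup G}"
      using Gmeas by (intro measure_mono_fmeasurable) (auto simp: fmeasurableD)
    also have "\<dots> = Sup G - Inf G"
      using cInf_le_cSup [OF ne bdd(2,1)] by simp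
    finally show "b - a - s \<le> Sup G - Inf G"
      using G_long by simp
    fix t
    assume "Inf G < t" "t < Sup G"
    then obtain t1 t2 where "t1 \<in> G" "t1 < t" "t2 \<in> G" "t < t2"
      using ne bdd by (metis cInf_less_iff less_cSup_iff)
    then have "t \<in> G"
      using mem_is_interval_1_I [OF Gint] by (meson less_imp_le)
    then show "\<exists>y z. (t, y) \<in> K \<and> (t, z) \<in> K \<and> s < z - y"
      by (simp add: G_def)
  qed
qed

text \<open>\<open>P\<close> may contain points on the axes; a short diagonal step from such a point
  leads into the open quadrant and stays in \<open>P\<close>.\<close>

lemma interior_nonempty_openin_quadrant:
  assumes "openin (top_of_set quadrant) P" "P \<noteq> {}"
  shows "interior P \<noteq> {}"
proof -
  obtain T where T: "open T" "P = quadrant \<inter> T"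
    using assms(1) by (auto simp: openin_open)
  obtain x y where xy: "(x, y) \<in> quadrant" "(x, y) \<in> T"
    using T(2) assms(2) by auto
  obtain e where e: "e > 0" "ball (x, y) e \<subseteq> T"
    using T(1) xy(2) openE by blast
  let ?v = "(x + e / 2, y + e / 2)"
  have "dist (x, y) ?v = sqrt (e\<^sup>2 / 2)"
    by (simp add: dist_prod_def dist_real_def power_divide)
  also have "\<dots> < sqrt (e\<^sup>2)"
    by (rule real_sqrt_less_mono) (use e(1) in simp)
  also have "\<dots> = e"
    using e(1) by simp
  finally have "?v \<in> T"
    using e(2) by auto
  moreover have "?v \<in> {0<..} \<times> {0<..}"
    using xy(1) e(1) by (simp add: quadrant_def)
  moreover have "open (({0<..} \<times> {0<..}) \<inter> T)"
    using T(1) by (intro open_Int open_Times) auto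
  moreover have "({0<..} \<times> {0<..}) \<inter> T \<subseteq> P"
    using T(2) by (auto simp: quadrant_def)
  ultimately show ?thesis
    using interior_maximal by blast
qed

text \<open>Passes from the closure back to \<open>P\<close>. Some interior point (t, v) lies on the
  same vertical line; a segment from it to a point of the closure stays in the interior, apart from
  that endpoint, and w equals v or lies between v and one of y, z.\<close>

lemma open_fibre_segment:
  fixes P :: "(real \<times> real) set"
  assumes P: "convex P" "interior P \<noteq> {}" and ab: "fst ` closure P = {a..b}" "t \<in> {a<..<b}"
    and yz: "(t, y) \<in> closure P" "(t, z) \<in> closure P" "y < w" "w < z"
  shows "(t, w) \<in> P"
proof -
  \<comment> \<open>Relative interior commutes with linear images of convex sets, so the interior
    projects onto (a,b).\<close>
  have "fst ` interior P = fst ` rel_interior (closure P)"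
    using convex_rel_interior_closure [OF P(1)] rel_interior_nonempty_interior [OF P(2)] by simp
  also have "\<dots> = rel_interior (fst ` closure P)"
    by (rule rel_interior_convex_linear_image) (auto intro: convex_closure P linear_fst)
  also have "\<dots> = {a<..<b}"
    using ab by (simp add: rel_interior_real_box)
  finally obtain v where v: "(t, v) \<in> interior P"
    using ab(2) by (metis (no_types, lifting) imageE prod.collapse)
  have *: "(t, w') \<in> P" if "(t, y') \<in> closure P" "w' \<in> open_segment v y'" for w' y'
  proof -
    have "(t, w') \<in> open_segment (t, v) (t, y')"
      using that(2) by (auto simp: in_segment algebra_simps)
    then show ?thesis
      using in_interior_closure_convex_segment [OF P(1) v that(1)] interior_subset by blast
  qed
  consider "w = v" | "w < v" | "v < w"
    by linarith
  then show ?thesis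
  proof cases
    case 1
    then show ?thesis
      using v interior_subset by blast
  next
    case 2
    then show ?thesis
      using * [OF yz(1)] yz(3) by (simp add: open_segment_eq_real_ivl)
  next
    case 3
    then show ?thesis
      using * [OF yz(2)] yz(4) by (simp add: open_segment_eq_real_ivl)
  qed
qed

section \<open>Lattice columns in dilates of the region, and the asymptotic estimate\<close>

theorem theorem2p2:
  fixes P :: "(real \<times> real) set" and a b m :: real
  assumes "P \<noteq> {}"
    and "convex P"
    and "openin (top_of_set quadrant) P"
    and "compact (closure P)"
    and "fst ` closure P = {a..b}"
    and "m > 0"
    and "m < b - a"
    and "\<forall>t\<in>{0<..m}. monotone_reordering a b (fibre_length (closure P)) t \<ge> t"
  shows "contains_asymptotically_non_special P m"
proof -
  have int: "interior P \<noteq> {}"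
    using interior_nonempty_openin_quadrant assms by blast
  have "closure P \<subseteq> {0..} \<times> {0..}"
    using openin_imp_subset [OF assms(3)]
    by (intro closure_minimal closed_Times) (auto simp: quadrant_def)
  then have nonneg: "0 \<le> t" "0 \<le> y" if "(t, y) \<in> closure P" for t y
    using that by auto
  have "a \<in> fst ` closure P"
    using assms(5-7) by simp
  then have "0 \<le> a"
    using nonneg by auto
  have columns: "\<exists>A :: nat set. card A = M - j \<and>
      (\<forall>\<alpha>\<in>A. \<exists>B. finite B \<and> card B = Suc j \<and>
        (\<forall>\<beta>\<in>B. (real \<alpha>, real \<beta>) \<in> (\<lambda>v. real k *\<^sub>R v) ` P))"
    if k: "0 < k" "2 \<le> real k * (b - a - m)" and M: "real M < real k * m" "j < M" for k M j :: nat
  proof -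
    \<comment> \<open>Dilation by k turns length s into j + 1, so longer fibres hold j + 1 lattice
      points. From j + 1 \<le> M < km follows s < m.\<close>
    define s where "s = real (Suc j) / real k"
    have ks: "real k * s = real (Suc j)"
      using k(1) by (simp add: s_def)
    have "real (Suc j) \<le> real M"
      using M(2) by linarith
    then have "s < m"
      using k(1) M(1) by (simp add: s_def divide_less_eq mult.commute)
    moreover have "0 \<le> s"
      by (simp add: s_def)
    ultimately obtain p q where pq: "a \<le> p" "q \<le> b" "b - a - s \<le> q - p"
      and fib: "\<And>t. p < t \<Longrightarrow> t < q \<Longrightarrow>
        \<exists>y z. (t, y) \<in> closure P \<and> (t, z) \<in> closure P \<and> s < z - y"
      using long_fibres_interval [OF convex_closure [OF assms(2)] assms(4,5,7) _ _ assms(8)] by metis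
    have "real k * (b - a - s) \<le> real k * (q - p)"
      using pq(3) by (rule mult_left_mono) simp
    moreover have "real (M - j) = real M - real j"
      using M(2) by (simp add: of_nat_diff)
    \<comment> \<open>Indeed k(q - p) \<ge> k(b - a) - (j + 1) \<ge> km + 2 - (j + 1) > M -
      j.\<close>
    ultimately have "real (M - j) < real k * q - real k * p"
      using k(2) M(1) ks by (simp add: algebra_simps)
    then obtain A where A: "card A = M - j" "\<And>\<alpha>. \<alpha> \<in> A \<Longrightarrow> real k * p < real \<alpha> \<and> real \<alpha> < real k * q"
      using open_interval_naturals [of "real k * p" "M - j" "real k * q"] pq(1) \<open>0 \<le> a\<close> by auto
    have "\<exists>B. finite B \<and> card B = Suc j \<and>
        (\<forall>\<beta>\<in>B. (real \<alpha>, real \<beta>) \<in> (\<lambda>v. real k *\<^sub>R v) ` P)" if "\<alpha> \<in> A" for \<alpha>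
    proof -
      define t where "t = real \<alpha> / real k"
      have t: "p < t" "t < q"
        using A(2) [OF that] k(1) by (auto simp: t_def field_simps)
      then obtain y z where yz: "(t, y) \<in> closure P" "(t, z) \<in> closure P" "s < z - y"
        using fib by blast
      have "real k * s < real k * (z - y)"
        using yz(3) k(1) by simp
      then have "real (Suc j) < real k * z - real k * y"
        using ks by (simp add: algebra_simps)
      then obtain B where B: "finite B" "card B = Suc j"
          "\<And>\<beta>. \<beta> \<in> B \<Longrightarrow> real k * y < real \<beta> \<and> real \<beta> < real k * z"
        using open_interval_naturals [of "real k * y" "Suc j" "real k * z"] nonneg(2) [OF yz(1)]
        by auto
      have "(real \<alpha>, real \<beta>) \<in> (\<lambda>v. real k *\<^sub>R v) ` P" if "\<beta> \<in> B" for \<beta>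
      proof
        show "(t, real \<beta> / real k) \<in> P"
          using open_fibre_segment [OF assms(2) int assms(5) _ yz(1,2)] B(3) [OF that] t pq k(1)
          by (auto simp: field_simps)
        show "(real \<alpha>, real \<beta>) = real k *\<^sub>R (t, real \<beta> / real k)"
          using k(1) by (simp add: t_def)
      qed
      then show ?thesis
        using B by blast
    qed
    then show ?thesis
      using A(1) by blast
  qed
  show ?thesis
    unfolding contains_asymptotically_non_special_def
  proof (intro allI impI)
    fix \<delta> :: real
    assume "\<delta> > 0"
    \<comment> \<open>The first bound gives the two spare columns required by
      \<open>columns\<close>, the second makes a rounding error of at most 1 smaller than
      \<delta>km.\<close>
    have "\<forall>\<^sub>F k in sequentially. real k > max (2 / (b - a - m)) (1 / (m * \<delta>))"
      by (rule eventually_compose_filterlim [OF eventually_gt_at_top filterlim_real_sequentially])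
    moreover have "\<forall>\<^sub>F k::nat in sequentially. k > 0"
      by (rule eventually_gt_at_top)
    ultimately show "\<forall>\<^sub>F k in sequentially. \<exists>(M::nat) D. finite D \<and>
        (\<forall>(\<alpha>, \<beta>)\<in>D. (real \<alpha>, real \<beta>) \<in> (\<lambda>v. real k *\<^sub>R v) ` P) \<and>
        non_special_of_dim_minus_one D M \<and> \<bar>(real M - real k * m) / (real k * m)\<bar> < \<delta>"
    proof eventually_elim
      case (elim k)
      have k: "2 \<le> real k * (b - a - m)" "1 < \<delta> * (real k * m)"
        using elim assms(6,7) \<open>\<delta> > 0\<close> by (auto simp: divide_less_eq mult_ac)
      have km: "0 < real k * m"
        using elim(2) assms(6) by simp
      \<comment> \<open>The largest natural number strictly below km, also when km is an integer; km
        > 0 keeps \<open>nat\<close> from truncating.\<close>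
      define M where "M = nat (\<lceil>real k * m\<rceil> - 1)"
      have M: "real M < real k * m" "real k * m \<le> real M + 1"
      proof -
        have "real M = of_int \<lceil>real k * m\<rceil> - 1"
          using km by (simp add: M_def of_nat_nat)
        then show "real M < real k * m" "real k * m \<le> real M + 1"
          by linarith+
      qed
      obtain A :: "nat \<Rightarrow> nat set" where A: "\<And>j. j < M \<Longrightarrow> card (A j) = M - j"
          "\<And>j \<alpha>. j < M \<Longrightarrow> \<alpha> \<in> A j \<Longrightarrow> \<exists>B. finite B \<and> card B = Suc j \<and>
            (\<forall>\<beta>\<in>B. (real \<alpha>, real \<beta>) \<in> (\<lambda>v. real k *\<^sub>R v) ` P)"
        using columns [OF elim(2) k(1) M(1)] by metis
      \<comment> \<open>Longest columns first: stage i draws from a set of i + 1 abscissae.\<close>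
      have "\<exists>h. inj_on h {..<M} \<and> (\<forall>i<M. h i \<in> A (M - Suc i))"
        by (rule distinct_representatives_greedy) (simp add: A(1))
      then obtain h where h: "inj_on h {..<M}" "\<And>i. i < M \<Longrightarrow> h i \<in> A (M - Suc i)"
        by blast
      \<comment> \<open>Reversing the index again gives abscissa \<open>g l\<close> a column of l +
        1 points.\<close>
      define g where "g l = h (M - Suc l)" for l
      have "inj_on g {..<M}"
        unfolding g_def
        by (rule inj_onI) (use inj_onD [OF h(1)] in \<open>fastforce dest: diff_Suc_less\<close>)
      moreover have "\<exists>B. finite B \<and> card B = Suc l \<and>
          (\<forall>\<beta>\<in>B. (real (g l), real \<beta>) \<in> (\<lambda>v. real k *\<^sub>R v) ` P)" if "l < M" for l
        using A(2) [OF that] h(2) [of "M - Suc l"] that by (simp add: g_def Suc_diff_Suc)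
      then obtain B where B: "\<And>l. l < M \<Longrightarrow> finite (B l)" "\<And>l. l < M \<Longrightarrow> card (B l) = Suc l"
          "\<And>l \<beta>. l < M \<Longrightarrow> \<beta> \<in> B l \<Longrightarrow> (real (g l), real \<beta>) \<in> (\<lambda>v. real k *\<^sub>R v) ` P"
        by metis
      ultimately have "non_special_of_dim_minus_one ((\<lambda>(l, \<beta>). (g l, \<beta>)) ` Sigma {..<M} B) M"
        by (intro non_special_columns)
      moreover have "\<bar>(real M - real k * m) / (real k * m)\<bar> < \<delta>"
      proof -
        have "\<bar>real M - real k * m\<bar> < \<delta> * (real k * m)"
          using M k(2) by linarith
        then show ?thesis
          using km by (simp add: abs_divide divide_less_eq)
      qed
      ultimately show ?case
        using B(1,3) by (intro exI [of _ M] exI [of _ "(\<lambda>(l, \<beta>). (g l, \<beta>)) ` Sigma {..<M} B"]) auto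
    qed
  qed
qed

end
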